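(* Let $p$ be a prime and let $\mathcal{G}$ be a permutation-like matrix group of dimension $p^2$. If $\mathcal{G}$ contains a maximal cycle $C$ such that the subgroup $\langle C\rangle$ generated by $C$ is normal in $\mathcal{G}$, then $\mathcal{G}$ is similar to a permutation matrix group, i.e. there exists an invertible matrix $Q\in \mathrm{GL}_{p^2}(\mathbb{C})$ such that $Q^{-1}AQ$ is a permutation matrix for every $A\in\mathcal{G}$.
   Context: A matrix group of dimension $n$ is a multiplicative group consisting of complex invertible $n\times n$ matrices, i.e. a subgroup of $\mathrm{GL}_n(\mathbb{C})$. A matrix group $\mathcal{G}$ is permutation-like if every matrix $A\in\mathcal{G}$ is similar (over $\mathbb{C}$, with conjugating matrix allowed to depend on $A$) to a permutation matrix. A matrix of dimension $n$ is called a maximal cycle if it is similar to a permutation matrix corresponding to a cycle permutation of length $n$ (i.e. a single $n$-cycle). *)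

theory Defs
  imports
    "Jordan_Normal_Form.Determinant"
    "HOL-Algebra.Generated_Groups"
    "HOL-Combinatorics.Cycles"
    "HOL-Computational_Algebra.Primes"
begin

definition GL :: "nat \<Rightarrow> complex mat monoid"
  where "GL n = units_of (ring_mat TYPE(complex) n ())"

definition matrix_group :: "nat \<Rightarrow> complex mat set \<Rightarrow> bool"
  where "matrix_group n G \<longleftrightarrow> subgroup G (GL n)"

text \<open>Indices run over \<open>{..<n}\<close>, and the matrix of \<open>\<sigma>\<close> sends
  the basis vector \<open>e\<^sub>j\<close> to \<open>e\<close> with index \<open>\<sigma> j\<close>.\<close>

definition perm_mat :: "nat \<Rightarrow> (nat \<Rightarrow> nat) \<Rightarrow> complex mat"
  where "perm_mat n \<sigma> = mat n n (\<lambda>(i, j). if i = \<sigma> j then 1 else 0)"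

definition permutation_matrix :: "nat \<Rightarrow> complex mat \<Rightarrow> bool"
  where "permutation_matrix n A \<longleftrightarrow> (\<exists>\<sigma>. \<sigma> permutes {..<n} \<and> A = perm_mat n \<sigma>)"

definition permutation_like :: "nat \<Rightarrow> complex mat set \<Rightarrow> bool"
  where "permutation_like n G \<longleftrightarrow>
    (\<forall>A\<in>G. \<exists>P. permutation_matrix n P \<and> similar_mat A P)"

text \<open>The library's \<open>cycle cs\<close> only says that the list is distinct; as its entries are
  exactly the \<open>n\<close> indices, \<open>cycle_of_list cs\<close> is a single cycle of length \<open>n\<close>.\<close>

definition maximal_cycle :: "nat \<Rightarrow> complex mat \<Rightarrow> bool"
  where "maximal_cycle n C \<longleftrightarrow>
    (\<exists>cs. cycle cs \<and> set cs = {..<n} \<and> similar_mat C (perm_mat n (cycle_of_list cs)))"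

end

theory Submission
  imports
    Defs
    "HOL-Analysis.Complex_Transcendental"
    "HOL-Number_Theory.Residue_Primitive_Roots"
begin

text \<open>
  Diagonalise \<open>C\<close> as the clock matrix \<open>diag(1, \<omega>, \<dots>, \<omega>\<^bsup>n-1\<^esup>)\<close> with \<open>n = p\<^sup>2\<close> and \<open>\<omega> = e\<^bsup>2\<pi>i/n\<^esup>\<close>.
  Since \<open>\<langle>C\<rangle>\<close> is normal, every element of the group becomes monomial, sending the basis
  vector \<open>v\<^sub>j\<close> to \<open>a\<^sub>j v\<^sub>k\<^sub>j\<close> for a unit \<open>k\<close> modulo \<open>n\<close>. The traces of its products with the powers
  of \<open>C\<close> are the Fourier transform of \<open>a\<close> restricted to the fixed points of \<open>k\<close>; they are natural
  numbers, and Parseval's identity forces this restriction to be a character, so that a power of \<open>C\<close>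
  normalises it to \<open>1\<close>. For \<open>k = 1\<close> this says that \<open>C\<close> generates its own centraliser.

  The units modulo \<open>p\<^sup>2\<close> form a cyclic group, so one normalised element \<open>B\<close> and \<open>C\<close> generate
  everything. The products of the coefficients of \<open>B\<close> along the cycles of \<open>k\<close> are all \<open>1\<close>, hence
  \<open>B\<close> fixes a vector \<open>w\<close> without zero coordinates, and \<open>B\<close> and \<open>C\<close> permute the basis
  \<open>w, C w, \<dots>, C\<^bsup>n-1\<^esup> w\<close>.
\<close>

section \<open>Roots of unity\<close>

definition unity_root :: "nat \<Rightarrow> complex"
  where "unity_root n = exp (2 * of_real pi * \<i> / of_nat n)"

lemma unity_root_power_eq_1_iff:
  assumes "n > 0"
  shows "unity_root n ^ m = 1 \<longleftrightarrow> n dvd m"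
proof -
  have "unity_root n ^ m = exp (2 * of_real pi * \<i> * of_nat m / of_nat n)"
    unfolding unity_root_def exp_of_nat_mult[symmetric] by (simp add: field_simps)
  then show ?thesis using complex_root_unity_eq_1[of n m] assms by simp
qed

lemma norm_unity_root [simp]: "norm (unity_root n) = 1"
  unfolding unity_root_def by simp

lemma unity_root_nonzero [simp]: "unity_root n \<noteq> 0"
  unfolding unity_root_def by simp

lemma unity_root_power_cong:
  assumes "n > 0" "[a = b] (mod n)"
  shows "unity_root n ^ a = unity_root n ^ b"
proof -
  have "unity_root n ^ a = unity_root n ^ (a mod n)" for a
  proof -
    have "unity_root n ^ a = unity_root n ^ (n * (a div n) + a mod n)" by simp
    also have "\<dots> = unity_root n ^ (a mod n)"
      using unity_root_power_eq_1_iff[OF assms(1), of n]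
      by (simp only: power_add power_mult) simp
    finally show ?thesis .
  qed
  from this[of a] this[of b] show ?thesis using assms(2) unfolding cong_def by simp
qed

lemma unity_root_power_eq_iff:
  assumes "n > 0"
  shows "unity_root n ^ a = unity_root n ^ b \<longleftrightarrow> [a = b] (mod n)"
proof
  have *: "[a = b] (mod n)" if "a \<le> b" "unity_root n ^ a = unity_root n ^ b" for a b
  proof -
    have "unity_root n ^ (b - a) = 1"
      using that by (simp add: power_diff)
    then have "n dvd b - a" using unity_root_power_eq_1_iff assms by blast
    then show ?thesis using that(1) by (metis cong_altdef_nat cong_sym)
  qed
  show "[a = b] (mod n)" if "unity_root n ^ a = unity_root n ^ b"
    using *[of a b] *[of b a] that by (metis cong_sym linear)
qed (rule unity_root_power_cong[OF assms])

lemma sum_unity_root_powers: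
  assumes "n > 0"
  shows "(\<Sum>j<n. unity_root n ^ (i * j)) = (if n dvd i then of_nat n else 0)"
proof (cases "n dvd i")
  case True
  then have "unity_root n ^ i = 1" using unity_root_power_eq_1_iff assms by blast
  then show ?thesis using True by (simp add: power_mult)
next
  case False
  then have "unity_root n ^ i \<noteq> 1" using unity_root_power_eq_1_iff assms by blast
  moreover have "(unity_root n ^ i) ^ n = 1"
    using unity_root_power_eq_1_iff[OF assms, of "i * n"] by (simp add: power_mult)
  ultimately show ?thesis using False
    by (simp add: power_mult geometric_sum)
qed

text \<open>Orthogonality of the characters modulo \<open>n\<close>. The conjugate is rewritten as a
  power with exponent \<open>(n - l) * j\<close>, so that exponents stay natural numbers and the
  geometric sum applies.\<close>

lemma sum_unity_root_orthogonal:
  assumes "i < n" "l < n"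
  shows "(\<Sum>j<n. unity_root n ^ (i * j) * cnj (unity_root n ^ (l * j))) = (if i = l then of_nat n else 0)"
proof -
  have n: "n > 0" using assms by simp
  have "cnj (unity_root n ^ (l * j)) = unity_root n ^ ((n - l) * j)" for j
  proof -
    have "unity_root n ^ (l * j) * unity_root n ^ ((n - l) * j) = unity_root n ^ (n * j)"
      using assms by (simp flip: power_add add: algebra_simps)
    also have "\<dots> = 1" using unity_root_power_eq_1_iff[OF n] by simp
    finally have "unity_root n ^ ((n - l) * j) = inverse (unity_root n ^ (l * j))"
      by (simp add: inverse_unique)
    also have "\<dots> = cnj (unity_root n ^ (l * j))"
      using complex_norm_square[of "unity_root n ^ (l * j)"]
      by (intro inverse_unique) (simp add: norm_power)
    finally show ?thesis by simp
  qed
  then have "(\<Sum>j<n. unity_root n ^ (i * j) * cnj (unity_root n ^ (l * j)))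
      = (\<Sum>j<n. unity_root n ^ ((i + (n - l)) * j))"
    by (simp add: power_add algebra_simps)
  moreover have "n dvd i + (n - l) \<longleftrightarrow> i = l"
  proof
    assume "n dvd i + (n - l)"
    then obtain c where "i + (n - l) = n * c" by blast
    moreover have "0 < i + (n - l)" "i + (n - l) < n * 2" using assms by auto
    ultimately have "c = 1" by (metis Suc_1 less_Suc_eq less_one mult_0_right n nat_mult_less_cancel1 not_gr_zero)
    then show "i = l" using \<open>i + (n - l) = n * c\<close> assms by simp
  qed (use assms in auto)
  ultimately show ?thesis using sum_unity_root_powers[OF n] by simp
qed

text \<open>The transforms \<open>t j\<close> lie in \<open>{0..card F}\<close>, and Parseval's identity gives
  \<open>(\<Sum>j<n. t j * (card F - t j)) = 0\<close>; so some \<open>t j\<close> attains the triangle inequality.\<close>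

lemma unimodular_fourier:
  fixes a :: "nat \<Rightarrow> complex"
  assumes F: "F \<subseteq> {..<n}" "0 \<in> F"
    and unim: "\<And>i. i \<in> F \<Longrightarrow> norm (a i) = 1"
    and nat: "\<And>j. (\<Sum>i\<in>F. a i * unity_root n ^ (i * j)) \<in> \<nat>"
  shows "\<exists>j. \<forall>i\<in>F. a i * unity_root n ^ (i * j) = 1"
proof -
  have n: "n > 0" using F by auto
  have fin: "finite F" using F finite_subset by blast
  define z where "z i j = a i * unity_root n ^ (i * j)" for i j
  have norm_z: "norm (z i j) = 1" if "i \<in> F" for i j
    using unim[OF that] by (simp add: z_def norm_mult norm_power)
  have "\<exists>t. (\<Sum>i\<in>F. z i j) = of_nat t" for j
    using nat[of j] unfolding z_def by (auto elim: Nats_cases)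
  then obtain t :: "nat \<Rightarrow> nat" where t: "(\<Sum>i\<in>F. z i j) = of_nat (t j)" for j
    by metis
  have t_le: "t j \<le> card F" for j
  proof -
    have "norm (\<Sum>i\<in>F. z i j) \<le> (\<Sum>i\<in>F. 1)"
      by (rule sum_norm_le) (simp add: norm_z)
    then show ?thesis by (simp add: t)
  qed
  \<comment> \<open>Fourier inversion at index 0: the only multiple of \<open>n\<close> in
    \<open>F\<close> is 0, so summing over all \<open>j\<close> isolates \<open>a 0\<close>, whose
    modulus 1 fixes the sum of the \<open>t j\<close> as \<open>n\<close>.\<close>
  have "of_nat (\<Sum>j<n. t j) = (\<Sum>i\<in>F. \<Sum>j<n. z i j)"
    by (simp flip: t add: sum.swap[of _ F])
  also have "\<dots> = (\<Sum>i\<in>F. if i = 0 then of_nat n * a 0 else 0)"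
  proof (rule sum.cong[OF refl])
    fix i assume "i \<in> F"
    then have "n dvd i \<longleftrightarrow> i = 0" using F(1) by (auto dest: nat_dvd_not_less intro: ccontr)
    then show "(\<Sum>j<n. z i j) = (if i = 0 then of_nat n * a 0 else 0)"
      using sum_unity_root_powers[OF n, of i]
      by (auto simp: z_def simp flip: sum_distrib_left)
  qed
  also have "\<dots> = of_nat n * a 0" using F(2) fin by simp
  finally have sum_t: "of_nat (\<Sum>j<n. t j) = of_nat n * a 0" .
  have "norm (of_nat (\<Sum>j<n. t j) :: complex) = norm (of_nat n * a 0)"
    unfolding sum_t ..
  then have "real (\<Sum>j<n. t j) = real n"
    using unim[OF F(2)] by (simp only: norm_mult norm_of_nat)
  then have s1: "(\<Sum>j<n. t j) = n" by linarith
  \<comment> \<open>Parseval: \<open>t j\<close> is real, so its square is the transform times its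
    conjugate. Orthogonality leaves the diagonal terms, where \<open>a\<close> has modulus
    1.\<close>
  have "of_nat (\<Sum>j<n. t j * t j) = (\<Sum>j<n. (\<Sum>i\<in>F. z i j) * cnj (\<Sum>l\<in>F. z l j))"
    by (simp add: t)
  also have "\<dots> = (\<Sum>j<n. \<Sum>i\<in>F. \<Sum>l\<in>F. z i j * cnj (z l j))"
    by (simp add: sum_product)
  also have "\<dots> = (\<Sum>i\<in>F. \<Sum>j<n. \<Sum>l\<in>F. z i j * cnj (z l j))"
    by (rule sum.swap)
  also have "\<dots> = (\<Sum>i\<in>F. \<Sum>l\<in>F. \<Sum>j<n. z i j * cnj (z l j))"
    by (intro sum.cong refl sum.swap)
  also have "\<dots> = (\<Sum>i\<in>F. \<Sum>l\<in>F. if i = l then of_nat n else 0)"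
  proof (intro sum.cong refl)
    fix i l assume il: "i \<in> F" "l \<in> F"
    have "(\<Sum>j<n. z i j * cnj (z l j))
        = a i * cnj (a l) * (\<Sum>j<n. unity_root n ^ (i * j) * cnj (unity_root n ^ (l * j)))"
      unfolding sum_distrib_left by (rule sum.cong[OF refl]) (simp add: z_def)
    also have "\<dots> = a i * cnj (a l) * (if i = l then of_nat n else 0)"
      using sum_unity_root_orthogonal[of i n l] il F(1) by (simp add: subset_iff)
    also have "\<dots> = (if i = l then of_nat n else 0)"
      using unim[OF il(1)] complex_norm_square[of "a i"] by (cases "i = l") simp_all
    finally show "(\<Sum>j<n. z i j * cnj (z l j)) = (if i = l then of_nat n else 0)" .
  qed
  also have "\<dots> = of_nat (n * card F)" using fin by simp
  finally have s2: "(\<Sum>j<n. t j * t j) = n * card F" by (simp only: of_nat_eq_iff)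
  have "(\<Sum>j<n. t j * (card F - t j)) + (\<Sum>j<n. t j * t j) = (\<Sum>j<n. t j * card F)"
    unfolding sum.distrib[symmetric] using t_le
    by (intro sum.cong refl) (simp flip: distrib_left)
  also have "\<dots> = n * card F" by (simp flip: sum_distrib_right add: s1)
  finally have "(\<Sum>j<n. t j * (card F - t j)) = 0" using s2 by simp
  then have 0: "t j * (card F - t j) = 0" if "j < n" for j using that by simp
  obtain j where j: "j < n" "t j \<noteq> 0"
    using s1 n by (metis lessThan_iff not_gr_zero sum.neutral)
  then have "t j = card F" using 0[OF j(1)] t_le[of j] by simp
  \<comment> \<open>Equality in the triangle inequality is exploited through real parts: each is at
    most 1 and they sum to \<open>card F\<close>.\<close>
  then have "(\<Sum>i\<in>F. Re (z i j)) = (\<Sum>i\<in>F. 1)"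
    using arg_cong[OF t[of j], of Re] by simp
  then have "(\<Sum>i\<in>F. 1 - Re (z i j)) = 0" by (simp add: sum_subtractf)
  moreover have Re_le: "Re (z i j) \<le> 1" if "i \<in> F" for i
    using complex_Re_le_cmod[of "z i j"] norm_z[OF that] by simp
  ultimately have "1 - Re (z i j) = 0" if "i \<in> F" for i
    using that fin by (subst (asm) sum_nonneg_eq_0_iff) auto
  then have Re1: "Re (z i j) = 1" if "i \<in> F" for i using that by force
  have "z i j = 1" if "i \<in> F" for i
    using Re1[OF that] norm_z[OF that, of j] by (simp add: complex_eq_iff cmod_def)
  then show ?thesis unfolding z_def by blast
qed

section \<open>Traces, permutation matrices and monomial matrices\<close>

definition mtrace :: "'a::comm_ring_1 mat \<Rightarrow> 'a"
  where "mtrace A = (\<Sum>i<dim_row A. A $$ (i, i))"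

lemma mtrace_mult_commute:
  assumes "A \<in> carrier_mat n m" "B \<in> carrier_mat m n"
  shows "mtrace (A * B) = mtrace (B * A)"
proof -
  have "mtrace (A * B) = (\<Sum>i<n. \<Sum>j<m. A $$ (i, j) * B $$ (j, i))"
    using assms by (simp add: mtrace_def scalar_prod_def atLeast0LessThan)
  also have "\<dots> = (\<Sum>j<m. \<Sum>i<n. B $$ (j, i) * A $$ (i, j))"
    by (subst sum.swap) (simp add: mult.commute)
  also have "\<dots> = mtrace (B * A)"
    using assms by (simp add: mtrace_def scalar_prod_def atLeast0LessThan)
  finally show ?thesis .
qed

lemma mtrace_similar:
  assumes "similar_mat A B"
  shows "mtrace A = mtrace B"
proof -
  from similar_matD[OF assms] obtain n P Q where
    *: "{A, B, P, Q} \<subseteq> carrier_mat n n" "Q * P = 1\<^sub>m n" "A = P * B * Q"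
    by blast
  then have "P * B \<in> carrier_mat n n" "Q \<in> carrier_mat n n" by (auto intro: mult_carrier_mat)
  then have "mtrace A = mtrace (Q * (P * B))"
    using mtrace_mult_commute *(3) by metis
  also have "Q * (P * B) = (Q * P) * B"
    using * by (intro assoc_mult_mat[symmetric]) auto
  also have "\<dots> = B" using * by (simp add: left_mult_one_mat[of B n n])
  finally show ?thesis .
qed

lemma similar_mat_pow:
  assumes "similar_mat A B"
  shows "similar_mat (A ^\<^sub>m k) (B ^\<^sub>m k)"
  using assms similar_mat_wit_pow unfolding similar_mat_def by blast

lemma perm_mat_carrier [simp]: "perm_mat n \<sigma> \<in> carrier_mat n n"
  by (simp add: perm_mat_def)

lemma perm_mat_dim [simp]: "dim_row (perm_mat n \<sigma>) = n" "dim_col (perm_mat n \<sigma>) = n"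
  by (simp_all add: perm_mat_def)

lemma mult_perm_mat_index:
  assumes "A \<in> carrier_mat m n" "i < m" "j < n" "\<sigma> j < n"
  shows "(A * perm_mat n \<sigma>) $$ (i, j) = A $$ (i, \<sigma> j)"
proof -
  have "(A * perm_mat n \<sigma>) $$ (i, j) = (\<Sum>t<n. A $$ (i, t) * (if t = \<sigma> j then 1 else 0))"
    using assms by (simp add: perm_mat_def scalar_prod_def atLeast0LessThan)
  also have "\<dots> = A $$ (i, \<sigma> j)"
    using assms by (simp add: if_distrib cong: if_cong)
  finally show ?thesis .
qed

lemma perm_mat_mult:
  assumes "\<tau> permutes {..<n}"
  shows "perm_mat n \<sigma> * perm_mat n \<tau> = perm_mat n (\<sigma> \<circ> \<tau>)"
proof (rule eq_matI)
  fix i j assume "i < dim_row (perm_mat n (\<sigma> \<circ> \<tau>))" "j < dim_col (perm_mat n (\<sigma> \<circ> \<tau>))"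
  then have ij: "i < n" "j < n" by simp_all
  then have "\<tau> j < n" using permutes_in_image[OF assms] by simp
  then show "(perm_mat n \<sigma> * perm_mat n \<tau>) $$ (i, j) = perm_mat n (\<sigma> \<circ> \<tau>) $$ (i, j)"
    using ij by (subst mult_perm_mat_index[of _ n]) (auto simp: perm_mat_def)
qed simp_all

lemma perm_mat_id: "perm_mat n id = 1\<^sub>m n"
  by (rule eq_matI) (auto simp: perm_mat_def)

lemma permutation_matrix_mult:
  assumes "permutation_matrix n A" "permutation_matrix n B"
  shows "permutation_matrix n (A * B)"
proof -
  from assms obtain \<sigma> \<tau> where "\<sigma> permutes {..<n}" "A = perm_mat n \<sigma>"
    "\<tau> permutes {..<n}" "B = perm_mat n \<tau>"
    unfolding permutation_matrix_def by blast
  then have "\<sigma> \<circ> \<tau> permutes {..<n}" "A * B = perm_mat n (\<sigma> \<circ> \<tau>)"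
    by (simp_all add: permutes_compose perm_mat_mult)
  then show ?thesis unfolding permutation_matrix_def by blast
qed

lemma permutation_matrix_one: "permutation_matrix n (1\<^sub>m n)"
  unfolding permutation_matrix_def using permutes_id perm_mat_id by metis

lemma perm_mat_pow:
  assumes "\<sigma> permutes {..<n}"
  shows "perm_mat n \<sigma> ^\<^sub>m r = perm_mat n (\<sigma> ^^ r)"
proof (induction r)
  case (Suc r)
  show ?case
    by (simp only: pow_mat.simps Suc.IH perm_mat_mult[OF assms] funpow_Suc_right)
qed (simp only: pow_mat.simps funpow.simps perm_mat_id perm_mat_dim)

lemma mtrace_perm_mat: "mtrace (perm_mat n \<sigma>) = of_nat (card {i. i < n \<and> \<sigma> i = i})"
proof -
  have "mtrace (perm_mat n \<sigma>) = (\<Sum>i\<in>{..<n}. if \<sigma> i = i then 1 else 0)"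
    unfolding mtrace_def by (auto simp: perm_mat_def intro!: sum.cong)
  also have "\<dots> = (\<Sum>i\<in>{i\<in>{..<n}. \<sigma> i = i}. 1)"
    by (rule sum.inter_filter[symmetric]) simp
  finally show ?thesis by simp
qed

section \<open>Matrices similar to a permutation matrix\<close>

definition similar_to_perm :: "nat \<Rightarrow> complex mat \<Rightarrow> bool"
  where "similar_to_perm n A \<longleftrightarrow> (\<exists>P. permutation_matrix n P \<and> similar_mat A P)"

lemma mtrace_similar_to_perm:
  assumes "similar_to_perm n A"
  shows "mtrace A \<in> \<nat>"
  using assms mtrace_similar mtrace_perm_mat
  unfolding similar_to_perm_def permutation_matrix_def by (metis of_nat_in_Nats)

text \<open>The trace counts fixed points of the underlying permutation, and a fixed point survives
  in every power.\<close>

lemma mtrace_pow_nonzero: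
  assumes "similar_to_perm n A" "mtrace A \<noteq> 0"
  shows "mtrace (A ^\<^sub>m r) \<noteq> 0"
proof -
  from assms(1) obtain \<sigma> where \<sigma>: "\<sigma> permutes {..<n}" "similar_mat A (perm_mat n \<sigma>)"
    unfolding similar_to_perm_def permutation_matrix_def by blast
  have "card {i. i < n \<and> \<sigma> i = i} \<noteq> 0"
    using assms(2) mtrace_similar[OF \<sigma>(2)] by (metis mtrace_perm_mat of_nat_0)
  then obtain i where "i < n" "\<sigma> i = i" by (auto simp: card_eq_0_iff)
  then have "i \<in> {i. i < n \<and> (\<sigma> ^^ r) i = i}" by (induction r) auto
  then have "card {i. i < n \<and> (\<sigma> ^^ r) i = i} \<noteq> 0" by (auto simp: card_eq_0_iff)
  then show ?thesis
    using mtrace_similar[OF similar_mat_pow[OF \<sigma>(2), of r]]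
    by (simp add: perm_mat_pow[OF \<sigma>(1)] mtrace_perm_mat)
qed

text \<open>Finite order passes from the permutation to the matrix. It is the source of all roots of
  unity among the coefficients of monomial elements.\<close>

lemma similar_to_perm_finite_order:
  assumes "similar_to_perm n A"
  shows "\<exists>N>0. A ^\<^sub>m N = 1\<^sub>m n"
proof -
  from assms obtain \<sigma> where \<sigma>: "\<sigma> permutes {..<n}" "similar_mat A (perm_mat n \<sigma>)"
    unfolding similar_to_perm_def permutation_matrix_def by blast
  then have "permutation \<sigma>" unfolding permutation_permutes by blast
  then obtain N where N: "\<sigma> ^^ N = id" "N > 0"
    by (rule permutation_is_nilpotent)
  from \<sigma>(2) obtain P Q where wit: "similar_mat_wit A (perm_mat n \<sigma>) P Q"
    unfolding similar_mat_def by blast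
  note w = similar_mat_witD[OF refl wit]
  have "dim_row A = n" using carrier_matD(1)[OF w(5)] by simp
  then have PQ: "P * Q = 1\<^sub>m n" "P \<in> carrier_mat n n" "Q \<in> carrier_mat n n"
    using w(1,6,7) by simp_all
  have "A ^\<^sub>m N = P * 1\<^sub>m n * Q"
    using similar_mat_wit_pow_id[OF wit, of N] by (simp add: perm_mat_pow[OF \<sigma>(1)] N perm_mat_id)
  also have "\<dots> = 1\<^sub>m n" using PQ by (simp add: right_mult_one_mat[of P n n])
  finally show ?thesis using N(2) by blast
qed

section \<open>Monomial matrices whose pattern is multiplication by \<open>k\<close> modulo
  \<open>n\<close>\<close>

definition monomial_mat :: "nat \<Rightarrow> nat \<Rightarrow> (nat \<Rightarrow> complex) \<Rightarrow> complex mat"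
  where "monomial_mat n k a = Matrix.mat n n (\<lambda>(i, j). if i = k * j mod n then a j else 0)"

lemma monomial_mat_carrier [simp]: "monomial_mat n k a \<in> carrier_mat n n"
  by (simp add: monomial_mat_def)

lemma monomial_mat_dim [simp]:
  "dim_row (monomial_mat n k a) = n" "dim_col (monomial_mat n k a) = n"
  by (simp_all add: monomial_mat_def)

lemma monomial_mat_cong:
  assumes "[k = k'] (mod n)" "\<And>j. j < n \<Longrightarrow> a j = a' j"
  shows "monomial_mat n k a = monomial_mat n k' a'"
proof -
  have "k * j mod n = k' * j mod n" for j
    using cong_mult[OF assms(1) cong_refl[of j n]] by (simp add: cong_def)
  then show ?thesis unfolding monomial_mat_def by (intro cong_mat) (auto simp: assms(2))
qed

lemma monomial_mat_inject:
  assumes "monomial_mat n k a = monomial_mat n k a'" "j < n"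
  shows "a j = a' j"
  using arg_cong[OF assms(1), of "\<lambda>A. A $$ (k * j mod n, j)"] assms(2)
  by (simp add: monomial_mat_def)

lemma monomial_mat_one: "monomial_mat n 1 (\<lambda>_. 1) = 1\<^sub>m n"
  by (rule eq_matI) (auto simp: monomial_mat_def)

lemma mult_monomial_mat_index:
  assumes "A \<in> carrier_mat m n" "i < m" "j < n"
  shows "(A * monomial_mat n k a) $$ (i, j) = A $$ (i, k * j mod n) * a j"
proof -
  have "(A * monomial_mat n k a) $$ (i, j)
      = (\<Sum>t<n. A $$ (i, t) * (if t = k * j mod n then a j else 0))"
    using assms by (simp add: monomial_mat_def scalar_prod_def atLeast0LessThan)
  also have "\<dots> = A $$ (i, k * j mod n) * a j"
    using assms by (simp add: if_distrib cong: if_cong)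
  finally show ?thesis .
qed

lemma monomial_mat_mult:
  "monomial_mat n k a * monomial_mat n l b = monomial_mat n (k * l) (\<lambda>j. b j * a (l * j mod n))"
proof (rule eq_matI)
  fix i j
  assume "i < dim_row (monomial_mat n (k * l) (\<lambda>j. b j * a (l * j mod n)))"
    "j < dim_col (monomial_mat n (k * l) (\<lambda>j. b j * a (l * j mod n)))"
  then have ij: "i < n" "j < n" by simp_all
  then show "(monomial_mat n k a * monomial_mat n l b) $$ (i, j)
      = monomial_mat n (k * l) (\<lambda>j. b j * a (l * j mod n)) $$ (i, j)"
    by (subst mult_monomial_mat_index[of _ n])
      (auto simp: monomial_mat_def mod_mult_right_eq mult.assoc)
qed simp_all

text \<open>The coefficients of a power are products along orbits of \<open>k\<close>, the cocycle
  values that \<open>cocycle_is_coboundary\<close> asks about.\<close>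

lemma monomial_mat_pow:
  "monomial_mat n k a ^\<^sub>m r = monomial_mat n (k ^ r) (\<lambda>j. \<Prod>s<r. a (k ^ s * j mod n))"
proof (induction r)
  case 0
  show ?case using monomial_mat_one by simp
next
  case (Suc r)
  \<comment> \<open>The next power multiplies by the base on the right, so the new factor
    \<open>a j\<close> comes first and the old product is shifted by one step.\<close>
  have "(\<Prod>s<r. a (k ^ s * (k * j mod n) mod n)) = (\<Prod>s<r. a (k ^ Suc s * j mod n))" for j
    by (simp add: mod_mult_right_eq ac_simps)
  then have "a j * (\<Prod>s<r. a (k ^ s * (k * j mod n) mod n)) = (\<Prod>s<Suc r. a (k ^ s * j mod n))"
    if "j < n" for j
    using that by (subst prod.lessThan_Suc_shift) simp
  then show ?case
    by (simp add: Suc.IH monomial_mat_mult) (intro monomial_mat_cong, auto simp: mult.commute)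
qed

lemma mtrace_monomial_mat:
  "mtrace (monomial_mat n k a) = (\<Sum>i | i < n \<and> k * i mod n = i. a i)"
proof -
  have "mtrace (monomial_mat n k a) = (\<Sum>i\<in>{..<n}. if k * i mod n = i then a i else 0)"
    unfolding mtrace_def by (auto simp: monomial_mat_def intro!: sum.cong)
  also have "\<dots> = (\<Sum>i\<in>{i\<in>{..<n}. k * i mod n = i}. a i)"
    by (rule sum.inter_filter[symmetric]) simp
  finally show ?thesis by simp
qed

section \<open>Cocycles and the clock matrix\<close>

text \<open>A form of the fact that subgroups of a cyclic group are cyclic, for the set
  \<open>E\<close> of exponents of the subgroup. The least positive exponent divides all others by
  division with remainder; \<open>period\<close> replaces subtraction.\<close>

lemma submonoid_nat_generator:
  fixes E :: "nat set"
  assumes "N \<in> E" "N > 0"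
    and add: "\<And>a b. a \<in> E \<Longrightarrow> b \<in> E \<Longrightarrow> a + b \<in> E"
    and period: "\<And>a. a + N \<in> E \<Longrightarrow> a \<in> E"
  shows "\<exists>d\<in>E. \<forall>e\<in>E. d dvd e"
proof -
  define d where "d = (LEAST e. e \<in> E \<and> e > 0)"
  have d: "d \<in> E" "d > 0"
    using LeastI[of "\<lambda>e. e \<in> E \<and> e > 0" N] assms(1,2) by (auto simp: d_def)
  have mult: "a + q * d \<in> E" if "a \<in> E" for a q
  proof (induction q)
    case (Suc q)
    from add[OF Suc.IH d(1)] show ?case by (simp add: add.assoc add.commute[of d])
  qed (simp add: that)
  have period': "a \<in> E" if "a + q * N \<in> E" for a q
    using that
  proof (induction q)
    case (Suc q)
    from Suc.prems have "(a + q * N) + N \<in> E" by (simp add: add.assoc add.commute[of N])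
    then show ?case using period Suc.IH by blast
  qed simp
  have "d dvd e" if "e \<in> E" for e
  proof -
    \<comment> \<open>Instead of subtracting \<open>e div d * d\<close> once, it is added
      \<open>N - 1\<close> times; this leaves the remainder up to a multiple of
      \<open>N\<close>.\<close>
    have "e + (e div d * (N - 1)) * d = e mod d + e div d * d + (e div d * (N - 1)) * d"
      by simp
    also have "\<dots> = e mod d + e div d * (d * (1 + (N - 1)))"
      by (simp only: algebra_simps)
    also have "\<dots> = e mod d + (e div d * d) * N"
      using assms(2) by simp
    finally have "e mod d + (e div d * d) * N \<in> E" using mult[OF that] by metis
    then have "e mod d \<in> E" by (rule period')
    moreover have "e mod d < d" using d(2) by simp
    ultimately have "e mod d = 0"
      using not_less_Least[of "e mod d" "\<lambda>e. e \<in> E \<and> e > 0", folded d_def] by auto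
    then show ?thesis by blast
  qed
  then show ?thesis using d(1) by blast
qed

text \<open>On each orbit \<open>w\<close> starts with 1 at a representative and is transported
  along \<open>f\<close> by the factors \<open>b\<close>. Since the product around every closed path
  is 1, the transported value does not depend on the number of steps.\<close>

lemma cocycle_is_coboundary:
  fixes f :: "'a \<Rightarrow> 'a" and b :: "'a \<Rightarrow> 'b::field"
  assumes maps: "\<And>x. x \<in> X \<Longrightarrow> f x \<in> X"
    and period: "N > 0" "\<And>x. x \<in> X \<Longrightarrow> (f ^^ N) x = x"
    and nonzero: "\<And>x. x \<in> X \<Longrightarrow> b x \<noteq> 0"
    and trivial: "\<And>x r. x \<in> X \<Longrightarrow> (f ^^ r) x = x \<Longrightarrow> (\<Prod>s<r. b ((f ^^ s) x)) = 1"
  shows "\<exists>w. \<forall>x\<in>X. w x \<noteq> 0 \<and> w (f x) = b x * w x"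
proof -
  define \<beta> where "\<beta> r x = (\<Prod>s<r. b ((f ^^ s) x))" for r x
  have maps': "(f ^^ r) x \<in> X" if "x \<in> X" for r x
    by (induction r) (auto simp: that maps)
  have \<beta>_add: "\<beta> (r + s) x = \<beta> r x * \<beta> s ((f ^^ r) x)" for r s x
    by (induction s) (simp_all add: \<beta>_def funpow_add add.commute mult.assoc)
  have \<beta>_unique: "\<beta> r x = \<beta> s x" if "x \<in> X" "(f ^^ r) x = (f ^^ s) x" for r s x
  proof -
    \<comment> \<open>If two step counts reach the same point, the surplus steps form a closed path
      there and contribute the factor 1.\<close>
    have "\<beta> s x = \<beta> r x" if "r \<le> s" "(f ^^ r) x = (f ^^ s) x" for r s
    proof -
      have "(f ^^ (s - r)) ((f ^^ r) x) = (f ^^ r) x"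
        using that by (metis add.commute comp_apply funpow_add le_add_diff_inverse)
      then have "\<beta> (s - r) ((f ^^ r) x) = 1"
        unfolding \<beta>_def using trivial maps' \<open>x \<in> X\<close> by blast
      then show ?thesis using \<beta>_add[of r "s - r" x] that(1) by simp
    qed
    from this[of r s] this[of s r] that(2) show ?thesis by (metis linear)
  qed
  \<comment> \<open>These are the points from which \<open>x\<close> is reachable. As
    \<open>f ^^ N\<close> is the identity on \<open>X\<close>, one step can be undone by
    \<open>N - 1\<close> further ones, so \<open>orb\<close> is constant along
    \<open>f\<close>.\<close>
  define orb where "orb x = {y \<in> X. \<exists>r. (f ^^ r) y = x}" for x
  have orb_step: "orb (f x) = orb x" if "x \<in> X" for x
  proof
    show "orb x \<subseteq> orb (f x)"
      unfolding orb_def by (auto intro: exI[of _ "Suc _"])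
    show "orb (f x) \<subseteq> orb x"
    proof
      fix y assume "y \<in> orb (f x)"
      then obtain r where y: "y \<in> X" "(f ^^ r) y = f x" unfolding orb_def by blast
      then have "(f ^^ (N - 1 + r)) y = (f ^^ (N - 1)) (f x)" by (simp add: funpow_add)
      also have "\<dots> = (f ^^ N) x"
        using period(1) by (metis Suc_diff_1 comp_apply funpow_Suc_right)
      finally show "y \<in> orb x" using y(1) period(2)[OF that] unfolding orb_def by auto
    qed
  qed
  \<comment> \<open>The choice depends on the set \<open>orb x\<close> only, so \<open>x\<close> and
    \<open>f x\<close> share their representative.\<close>
  define rep where "rep x = (SOME y. y \<in> orb x)" for x
  have rep: "rep x \<in> orb x" if "x \<in> X" for x
  proof -
    have "x \<in> orb x" using that unfolding orb_def by (auto intro: exI[of _ 0])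
    then show ?thesis unfolding rep_def by (rule someI)
  qed
  define w where "w x = \<beta> (SOME r. (f ^^ r) (rep x) = x) (rep x)" for x
  have w: "w x = \<beta> r (rep x)" if "x \<in> X" "(f ^^ r) (rep x) = x" for x r
  proof -
    have "(f ^^ (SOME r. (f ^^ r) (rep x) = x)) (rep x) = x" using that(2) by (rule someI)
    then show ?thesis
      unfolding w_def using \<beta>_unique[of "rep x"] rep[OF that(1)] that(2) unfolding orb_def by auto
  qed
  have "w x \<noteq> 0 \<and> w (f x) = b x * w x" if x: "x \<in> X" for x
  proof -
    obtain r where r: "rep x \<in> X" "(f ^^ r) (rep x) = x" using rep[OF x] unfolding orb_def by blast
    have "rep (f x) = rep x" unfolding rep_def orb_step[OF x] ..
    then have "(f ^^ Suc r) (rep (f x)) = f x" using r(2) by simp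
    then have "w (f x) = \<beta> (Suc r) (rep x)"
      using w[OF maps[OF x], of "Suc r"] \<open>rep (f x) = rep x\<close> by simp
    also have "\<dots> = b x * \<beta> r (rep x)" using r(2) by (simp add: \<beta>_def)
    finally have "w (f x) = b x * w x" using w[OF x r(2)] by simp
    moreover have "w x \<noteq> 0"
      using w[OF x r(2)] nonzero maps'[OF r(1)] by (simp add: \<beta>_def)
    ultimately show ?thesis by blast
  qed
  then show ?thesis by blast
qed

section \<open>Clock matrices, encoded as monomial matrices with multiplier 1, and their Fourier
  bases\<close>

definition clock_mat :: "nat \<Rightarrow> nat \<Rightarrow> complex mat"
  where "clock_mat n s = monomial_mat n 1 (\<lambda>j. unity_root n ^ (s * j))"

lemma monomial_mat_clock:
  "monomial_mat n k a * clock_mat n s = monomial_mat n k (\<lambda>j. a j * unity_root n ^ (s * j))"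
  unfolding clock_mat_def monomial_mat_mult by (intro monomial_mat_cong) auto

lemma clock_mat_zero: "clock_mat n 0 = 1\<^sub>m n"
  unfolding clock_mat_def using monomial_mat_one by simp

lemma clock_mat_pow: "clock_mat n 1 ^\<^sub>m s = clock_mat n s"
proof (induction s)
  case 0
  show ?case by (simp add: clock_mat_zero) (simp add: clock_mat_def)
next
  case (Suc s)
  have "clock_mat n 1 ^\<^sub>m Suc s = clock_mat n s * clock_mat n 1"
    by (simp only: pow_mat.simps Suc.IH)
  also have "\<dots> = clock_mat n (Suc s)"
    unfolding clock_mat_def[of n s] monomial_mat_clock unfolding clock_mat_def
    by (intro monomial_mat_cong) (auto simp: power_add)
  finally show ?case .
qed

text \<open>The columns are the images of the vector \<open>w\<close> under the powers of the clock matrix.\<close>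

definition weighted_dft :: "nat \<Rightarrow> (nat \<Rightarrow> complex) \<Rightarrow> complex mat"
  where "weighted_dft n w = Matrix.mat n n (\<lambda>(i, j). w i * unity_root n ^ (i * j))"

lemma weighted_dft_carrier [simp]: "weighted_dft n w \<in> carrier_mat n n"
  by (simp add: weighted_dft_def)

text \<open>The matrix is the diagonal matrix of \<open>w\<close> times the Fourier matrix. Its
  inverse is the conjugate transpose of the latter, divided by \<open>n\<close> and by the
  weights.\<close>

lemma weighted_dft_inverse:
  assumes "\<And>i. i < n \<Longrightarrow> w i \<noteq> 0"
  obtains R where "R \<in> carrier_mat n n" "weighted_dft n w * R = 1\<^sub>m n" "R * weighted_dft n w = 1\<^sub>m n"
proof -
  define R where "R = Matrix.mat n n (\<lambda>(j, l). cnj (unity_root n ^ (l * j)) / (of_nat n * w l))"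
  have R: "R \<in> carrier_mat n n" by (simp add: R_def)
  have 1: "weighted_dft n w * R = 1\<^sub>m n"
  proof (rule eq_matI)
    fix i l assume "i < dim_row (1\<^sub>m n :: complex mat)" "l < dim_col (1\<^sub>m n :: complex mat)"
    then have il: "i < n" "l < n" by simp_all
    have "(weighted_dft n w * R) $$ (i, l)
        = (\<Sum>j<n. w i / (of_nat n * w l) * (unity_root n ^ (i * j) * cnj (unity_root n ^ (l * j))))"
      using il by (auto simp: weighted_dft_def R_def scalar_prod_def atLeast0LessThan intro!: sum.cong)
    also have "\<dots> = w i / (of_nat n * w l) * (if i = l then of_nat n else 0)"
      unfolding sum_distrib_left[symmetric] sum_unity_root_orthogonal[OF il] ..
    also have "\<dots> = 1\<^sub>m n $$ (i, l)" using il assms by auto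
    finally show "(weighted_dft n w * R) $$ (i, l) = 1\<^sub>m n $$ (i, l)" .
  qed (simp_all add: weighted_dft_def R_def)
  show ?thesis
    using that[OF R 1] mat_mult_left_right_inverse[OF weighted_dft_carrier R 1] by blast
qed

lemma affine_permutation_matrix:
  assumes "coprime l n"
  shows "permutation_matrix n (perm_mat n (\<lambda>j. l * (s + j) mod n))"
proof -
  \<comment> \<open>\<open>permutes\<close> demands the identity outside \<open>{..<n}\<close>,
    whereas \<open>perm_mat\<close> reads its argument only below \<open>n\<close>.\<close>
  define \<pi> where "\<pi> j = (if j < n then l * (s + j) mod n else j)" for j
  have "inj_on \<pi> {..<n}"
  proof (rule inj_onI)
    fix i j assume ij: "i \<in> {..<n}" "j \<in> {..<n}" and "\<pi> i = \<pi> j"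
    then have "[l * (s + i) = l * (s + j)] (mod n)" by (simp add: \<pi>_def cong_def)
    then have "[s + i = s + j] (mod n)" using assms cong_mult_lcancel_nat by blast
    then have "[i = j] (mod n)" using cong_add_lcancel_nat by blast
    then show "i = j" using ij by (simp add: cong_def)
  qed
  moreover have "\<pi> ` {..<n} \<subseteq> {..<n}" by (auto simp: \<pi>_def)
  ultimately have "bij_betw \<pi> {..<n} {..<n}"
    by (simp add: bij_betw_def endo_inj_surj)
  then have "\<pi> permutes {..<n}" by (rule bij_imp_permutes) (simp add: \<pi>_def)
  moreover have "perm_mat n (\<lambda>j. l * (s + j) mod n) = perm_mat n \<pi>"
    unfolding perm_mat_def by (intro cong_mat) (auto simp: \<pi>_def)
  ultimately show ?thesis unfolding permutation_matrix_def by blast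
qed

text \<open>Let A be the monomial matrix and D the clock matrix. As \<open>l\<close> inverts
  \<open>k\<close>, A D^j = D^(lj) A, and the second hypothesis says A w = D^(ls) w. So column
  \<open>j\<close>, which is D^j w, goes to column \<open>l * (s + j)\<close> modulo
  \<open>n\<close>. The generator uses \<open>s = 0\<close>, the clock matrices use
  \<open>k = l = 1\<close>.\<close>

lemma monomial_mat_permutes_weighted_dft:
  assumes l: "[l * k = 1] (mod n)"
    and a: "\<And>t. t < n \<Longrightarrow> a t * w t = unity_root n ^ (s * t) * w (k * t mod n)"
  shows "monomial_mat n k a * weighted_dft n w
    = weighted_dft n w * perm_mat n (\<lambda>j. l * (s + j) mod n)"
proof (rule eq_matI)
  fix i j
  assume "i < dim_row (weighted_dft n w * perm_mat n (\<lambda>j. l * (s + j) mod n))"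
    "j < dim_col (weighted_dft n w * perm_mat n (\<lambda>j. l * (s + j) mod n))"
  then have ij: "i < n" "j < n" by (simp_all add: weighted_dft_def)
  then have n: "n > 0" by simp
  \<comment> \<open>The only column of the monomial matrix whose entry lies in row
    \<open>i\<close>.\<close>
  define t where "t = l * i mod n"
  have t: "t < n" using n by (simp add: t_def)
  have row: "i = k * u mod n \<longleftrightarrow> u = t" if "u < n" for u
  proof
    assume "i = k * u mod n"
    then have "[l * i = l * (k * u)] (mod n)" by (simp add: cong_def mod_mult_right_eq)
    also have "[l * (k * u) = u] (mod n)"
      using cong_mult[OF l cong_refl[of u n]] by (simp add: mult.assoc)
    finally show "u = t" using that by (simp add: cong_def t_def)
  next
    assume "u = t"
    then have "[k * u = k * (l * i)] (mod n)" by (simp add: cong_def mod_mult_right_eq t_def)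
    also have "[k * (l * i) = i] (mod n)"
      using cong_mult[OF l cong_refl[of i n]] by (simp add: ac_simps)
    finally show "i = k * u mod n" using ij by (simp add: cong_def)
  qed
  have "(monomial_mat n k a * weighted_dft n w) $$ (i, j)
      = (\<Sum>u<n. monomial_mat n k a $$ (i, u) * weighted_dft n w $$ (u, j))"
    using ij by (simp add: weighted_dft_def scalar_prod_def atLeast0LessThan)
  also have "\<dots> = (\<Sum>u<n. if u = t then a t * w t * unity_root n ^ (t * j) else 0)"
    using ij row by (intro sum.cong) (auto simp: monomial_mat_def weighted_dft_def)
  also have "\<dots> = (a t * w t) * unity_root n ^ (t * j)" using t by simp
  also have "\<dots> = w i * unity_root n ^ (t * (s + j))"
    using a[OF t] row[OF t] by (simp add: power_add algebra_simps)
  also have "\<dots> = w i * unity_root n ^ (i * (l * (s + j) mod n))"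
  proof -
    have "[t * (s + j) = l * i * (s + j)] (mod n)"
      unfolding t_def by (simp add: cong_def mod_mult_left_eq)
    also have "[l * i * (s + j) = i * (l * (s + j) mod n)] (mod n)"
      by (simp add: cong_def mod_mult_right_eq ac_simps)
    finally show ?thesis using unity_root_power_cong[OF n] by metis
  qed
  also have "\<dots> = (weighted_dft n w * perm_mat n (\<lambda>j. l * (s + j) mod n)) $$ (i, j)"
    using ij n by (subst mult_perm_mat_index[of _ n]) (auto simp: weighted_dft_def)
  finally show "(monomial_mat n k a * weighted_dft n w) $$ (i, j)
      = (weighted_dft n w * perm_mat n (\<lambda>j. l * (s + j) mod n)) $$ (i, j)" .
qed (simp_all add: weighted_dft_def)

section \<open>Monomial permutation-like groups\<close>

lemma pow_mat_commute:
  assumes A: "A \<in> carrier_mat n n"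
  shows "A * A ^\<^sub>m r = A ^\<^sub>m r * A"
proof (induction r)
  case 0
  show ?case using A by (simp add: left_mult_one_mat[OF A] right_mult_one_mat[OF A])
next
  case (Suc r)
  have "A * A ^\<^sub>m Suc r = A * A ^\<^sub>m r * A"
    using assoc_mult_mat[OF A pow_carrier_mat[OF A] A] by simp
  then show ?case by (simp add: Suc.IH)
qed

lemma conj_mat_mult:
  fixes A B Q R :: "'a::semiring_1 mat"
  assumes A: "A \<in> carrier_mat n n" and B: "B \<in> carrier_mat n n"
    and Q: "Q \<in> carrier_mat n n" and R: "R \<in> carrier_mat n n" and QR: "Q * R = 1\<^sub>m n"
  shows "R * A * Q * (R * B * Q) = R * (A * B) * Q"
proof -
  have RA: "R * A \<in> carrier_mat n n" and BQ: "B * Q \<in> carrier_mat n n"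
    using A B Q R by simp_all
  have "R * A * Q * (R * B * Q) = R * A * Q * (R * (B * Q))"
    unfolding assoc_mult_mat[OF R B Q] ..
  also have "\<dots> = R * A * Q * R * (B * Q)"
    by (rule assoc_mult_mat[symmetric, OF mult_carrier_mat[OF RA Q] R BQ])
  also have "R * A * Q * R = R * A"
    unfolding assoc_mult_mat[OF RA Q R] QR by (rule right_mult_one_mat[OF RA])
  also have "R * A * (B * Q) = R * (A * B) * Q"
    unfolding assoc_mult_mat[OF RA B Q, symmetric] assoc_mult_mat[OF R A B] ..
  finally show ?thesis .
qed

text \<open>Column 1 reveals the multiplier, since its entry lies in row \<open>k mod n\<close>;
  this column exists because \<open>n > 1\<close>.\<close>

lemma monomial_mat_eq_one:
  assumes "monomial_mat n k a = 1\<^sub>m n" "n > 1"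
  shows "[k = 1] (mod n)"
  using arg_cong[OF assms(1), of "\<lambda>A. A $$ (1, 1)"] assms(2)
  by (auto simp: monomial_mat_def cong_def split: if_splits)

text \<open>The group after the basis change that turns \<open>C\<close> into the clock matrix.
  Normality of the subgroup generated by \<open>C\<close> is recorded only through the monomial
  shape of all elements.\<close>

locale monomial_perm_like_group =
  fixes p n :: nat and S :: "complex mat set"
  assumes prime_p: "Factorial_Ring.prime p" and n_def: "n = p\<^sup>2"
    and mult_closed: "A \<in> S \<Longrightarrow> B \<in> S \<Longrightarrow> A * B \<in> S"
    and inverse_closed: "A \<in> S \<Longrightarrow> \<exists>B\<in>S. A * B = 1\<^sub>m n \<and> B * A = 1\<^sub>m n"
    and clock_closed: "clock_mat n 1 \<in> S"
    and monomial: "A \<in> S \<Longrightarrow> \<exists>k a. coprime k n \<and> A = monomial_mat n k a"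
    and perm_like: "A \<in> S \<Longrightarrow> similar_to_perm n A"
begin

lemma n_gt_1: "n > 1"
  using one_less_power[OF prime_gt_1_nat[OF prime_p], of 2] by (simp add: n_def)

lemma n_pos: "n > 0" using n_gt_1 by simp

lemma one_closed: "1\<^sub>m n \<in> S"
  using inverse_closed[OF clock_closed] mult_closed[OF clock_closed] by metis

lemma carrier: "A \<in> S \<Longrightarrow> A \<in> carrier_mat n n"
  using monomial by fastforce

lemma pow_closed:
  assumes "A \<in> S"
  shows "A ^\<^sub>m r \<in> S"
proof (induction r)
  case 0
  then show ?case using carrier[OF assms] one_closed by simp
next
  case (Suc r)
  then show ?case using assms mult_closed by simp
qed

lemma clock_pow_closed: "clock_mat n s \<in> S"
  using pow_closed[OF clock_closed] clock_mat_pow by metis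

text \<open>Finite order, read off on the diagonal of the power; one \<open>N\<close> serves all
  indices.\<close>

lemma coeff_cycle_root:
  assumes "monomial_mat n k a \<in> S"
  obtains N where "N > 0" "\<And>i. i < n \<Longrightarrow> k ^ N * i mod n = i"
    "\<And>i. i < n \<Longrightarrow> (\<Prod>s<N. a (k ^ s * i mod n)) = 1"
proof -
  obtain N where N: "N > 0" "monomial_mat n k a ^\<^sub>m N = 1\<^sub>m n"
    using similar_to_perm_finite_order[OF perm_like[OF assms]] by blast
  then have eq: "monomial_mat n (k ^ N) (\<lambda>j. \<Prod>s<N. a (k ^ s * j mod n)) = 1\<^sub>m n"
    by (simp add: monomial_mat_pow)
  have *: "k ^ N * i mod n = i \<and> (\<Prod>s<N. a (k ^ s * i mod n)) = 1" if "i < n" for i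
    using arg_cong[OF eq, of "\<lambda>A. A $$ (i, i)"] that
    by (auto simp: monomial_mat_def split: if_splits)
  show ?thesis using that[OF N(1)] * by blast
qed

lemma coeff_nonzero:
  assumes "monomial_mat n k a \<in> S" "i < n"
  shows "a i \<noteq> 0"
proof -
  obtain N where N: "N > 0" "(\<Prod>s<N. a (k ^ s * i mod n)) = 1"
    using coeff_cycle_root[OF assms(1)] assms(2) by metis
  then have "a (k ^ 0 * i mod n) \<noteq> 0"
    by (metis (no_types, lifting) finite_lessThan lessThan_iff prod_zero_iff zero_neq_one)
  then show ?thesis using assms(2) by simp
qed

lemma power_fixes:
  assumes "i < n" "k * i mod n = i"
  shows "k ^ s * i mod n = i"
proof (induction s)
  case (Suc s)
  have "k ^ Suc s * i mod n = k ^ s * (k * i mod n) mod n"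
    by (simp add: mod_mult_right_eq ac_simps)
  then show ?case using Suc.IH assms(2) by simp
qed (use assms in simp)

text \<open>Both hypotheses of \<open>unimodular_fourier\<close> hold: finite order makes the
  coefficients at fixed points roots of unity, and their transforms are traces of products with
  clock matrices, hence natural numbers.\<close>

lemma fixed_coeffs_are_character:
  assumes A: "monomial_mat n k a \<in> S"
  shows "\<exists>j. \<forall>i<n. k * i mod n = i \<longrightarrow> a i * unity_root n ^ (i * j) = 1"
proof -
  define F where "F = {i. i < n \<and> k * i mod n = i}"
  have "\<exists>j. \<forall>i\<in>F. a i * unity_root n ^ (i * j) = 1"
  proof (rule unimodular_fourier)
    show "F \<subseteq> {..<n}" "0 \<in> F" using n_pos by (auto simp: F_def)
  next
    fix i assume "i \<in> F"
    then have i: "i < n" "k * i mod n = i" by (auto simp: F_def)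
    obtain N where N: "N > 0" "(\<Prod>s<N. a (k ^ s * i mod n)) = 1"
      using coeff_cycle_root[OF A] i(1) by metis
    then have "a i ^ N = 1" by (simp add: power_fixes[OF i])
    then have "norm (a i) ^ N = 1" by (metis norm_one norm_power)
    then show "norm (a i) = 1" using power_eq_imp_eq_base[of "norm (a i)" N 1] N(1) by simp
  next
    fix j
    have "monomial_mat n k a * clock_mat n j \<in> S" using A clock_pow_closed mult_closed by blast
    then have "mtrace (monomial_mat n k a * clock_mat n j) \<in> \<nat>"
      using perm_like mtrace_similar_to_perm by blast
    then show "(\<Sum>i\<in>F. a i * unity_root n ^ (i * j)) \<in> \<nat>"
      by (simp add: monomial_mat_clock mtrace_monomial_mat F_def mult.commute)
  qed
  then show ?thesis by (auto simp: F_def)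
qed

text \<open>With multiplier 1 every index is fixed, so the whole coefficient function is a
  character.\<close>

lemma centralizer_is_clock:
  assumes "monomial_mat n k a \<in> S" "[k = 1] (mod n)"
  shows "\<exists>s. monomial_mat n k a = clock_mat n s"
proof -
  obtain j where j: "\<And>i. i < n \<Longrightarrow> k * i mod n = i \<Longrightarrow> a i * unity_root n ^ (i * j) = 1"
    using fixed_coeffs_are_character[OF assms(1)] by blast
  have fixed: "k * i mod n = i" if "i < n" for i
    using cong_mult[OF assms(2) cong_refl[of i n]] that by (simp add: cong_def)
  \<comment> \<open>\<open>j * (n - 1)\<close> is a natural number congruent to -j modulo
    \<open>n\<close>.\<close>
  have "a i = unity_root n ^ (j * (n - 1) * i)" if "i < n" for i
  proof -
    have "unity_root n ^ (i * j) * unity_root n ^ (j * (n - 1) * i) = unity_root n ^ (n * (i * j))"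
    proof -
      have "i * j + j * (n - 1) * i = i * j * (1 + (n - 1))" by (simp only: algebra_simps)
      then show ?thesis using n_pos by (simp flip: power_add add: mult.commute)
    qed
    also have "\<dots> = 1" using unity_root_power_eq_1_iff[OF n_pos] by simp
    finally show ?thesis using j[OF that fixed[OF that]]
      by (metis mult.assoc mult.commute mult_1)
  qed
  then have "monomial_mat n k a = clock_mat n (j * (n - 1))"
    unfolding clock_mat_def by (intro monomial_mat_cong assms(2))
  then show ?thesis ..
qed

text \<open>Every multiplier is a power of a primitive root \<open>g\<close>. The exponents that
  occur are closed under addition and periodic with period \<open>totient n\<close>, so all are
  multiples of one of them, \<open>d\<close>, and \<open>g ^ d\<close> generates.\<close>

lemma cyclic_multipliers:
  "\<exists>k a. coprime k n \<and> monomial_mat n k a \<in> S \<and> (\<forall>A\<in>S. \<exists>e b. A = monomial_mat n (k ^ e) b)"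
proof -
  \<comment> \<open>The modulus 4 is handled apart from the powers of odd primes.\<close>
  have "n \<in> cyclic_moduli"
  proof (cases "p = 2")
    case False
    then have "odd p"
      using prime_ge_2_nat[OF prime_p] prime_odd_nat[OF prime_p] by simp
    then have "n \<in> {p ^ k |p k. Factorial_Ring.prime p \<and> odd p \<and> k > 0}"
      using prime_p unfolding n_def by (intro CollectI exI[of _ p] exI[of _ 2]) simp
    then show ?thesis unfolding cyclic_moduli_def by blast
  qed (simp add: n_def cyclic_moduli_def)
  then obtain g where g: "residue_primroot n g" using residue_primroot_iff_in_cyclic_moduli by blast
  then have cop: "coprime g n" by (simp add: residue_primroot_def coprime_commute)
  have gen: "\<exists>e. [k = g ^ e] (mod n)" if "coprime k n" for k
  proof -
    have "\<not> n dvd k" using that n_gt_1 coprime_absorb_right[of n k] by auto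
    then have "k mod n \<in> totatives n"
      using that n_gt_1 by (auto simp: totatives_def mod_greater_zero_iff_not_dvd)
    then obtain e where "g ^ e mod n = k mod n"
      using residue_primroot_is_generator[OF n_gt_1 g] unfolding bij_betw_def
      by (metis (no_types, lifting) imageE)
    then show ?thesis unfolding cong_def by metis
  qed
  define E where "E = {e. \<exists>a. monomial_mat n (g ^ e) a \<in> S}"
  have "\<exists>d\<in>E. \<forall>e\<in>E. d dvd e"
  proof (rule submonoid_nat_generator[of "totient n"])
    have tot: "[g ^ totient n = 1] (mod n)" using euler_theorem[OF cop] .
    then have "monomial_mat n (g ^ totient n) (\<lambda>_. 1) = 1\<^sub>m n"
      unfolding monomial_mat_one[symmetric] by (intro monomial_mat_cong) auto
    then show "totient n \<in> E" using one_closed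
      unfolding E_def by (intro CollectI exI[of _ "\<lambda>_. 1"]) simp
    show "totient n > 0" using n_pos by simp
    show "a + b \<in> E" if ab: "a \<in> E" "b \<in> E" for a b
    proof -
      obtain x where x: "monomial_mat n (g ^ a) x \<in> S"
        using ab(1) unfolding E_def mem_Collect_eq ..
      obtain y where y: "monomial_mat n (g ^ b) y \<in> S"
        using ab(2) unfolding E_def mem_Collect_eq ..
      from mult_closed[OF x y] show ?thesis
        unfolding E_def monomial_mat_mult power_add[symmetric] by (intro CollectI exI)
    qed
    show "a \<in> E" if a: "a + totient n \<in> E" for a
    proof -
      have "[g ^ (a + totient n) = g ^ a] (mod n)"
        using cong_mult[OF cong_refl[of "g ^ a" n] tot] by (simp add: power_add)
      then have *: "monomial_mat n (g ^ (a + totient n)) b = monomial_mat n (g ^ a) b" for b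
        by (intro monomial_mat_cong) auto
      obtain b where "monomial_mat n (g ^ (a + totient n)) b \<in> S"
        using a unfolding E_def mem_Collect_eq ..
      then show ?thesis unfolding E_def * by (intro CollectI exI)
    qed
  qed
  then obtain d where d: "d \<in> E" "\<And>e. e \<in> E \<Longrightarrow> d dvd e" by blast
  obtain a where "monomial_mat n (g ^ d) a \<in> S"
    using d(1) unfolding E_def mem_Collect_eq ..
  moreover have "\<exists>e b. A = monomial_mat n ((g ^ d) ^ e) b" if A_in: "A \<in> S" for A
  proof -
    obtain k b where k: "coprime k n" "A = monomial_mat n k b" using monomial[OF A_in] by blast
    obtain e where e: "[k = g ^ e] (mod n)" using gen[OF k(1)] by blast
    have A: "A = monomial_mat n (g ^ e) b"
      unfolding k(2) using e by (intro monomial_mat_cong) auto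
    then have "e \<in> E" using A_in unfolding E_def by blast
    then obtain q where "e = d * q" using d(2) by blast
    then show ?thesis using A by (auto simp: power_mult)
  qed
  ultimately show ?thesis using cop by (intro exI[of _ "g ^ d"] exI[of _ a]) auto
qed

text \<open>Multiplying by a clock matrix keeps the multiplier and cancels the character found at
  the fixed points.\<close>

lemma normalized_generator:
  "\<exists>k b. coprime k n \<and> monomial_mat n k b \<in> S \<and> (\<forall>i<n. k * i mod n = i \<longrightarrow> b i = 1) \<and>
     (\<forall>A\<in>S. \<exists>e a. A = monomial_mat n (k ^ e) a)"
proof -
  obtain k a where k: "coprime k n" "monomial_mat n k a \<in> S"
    "\<forall>A\<in>S. \<exists>e b. A = monomial_mat n (k ^ e) b"
    using cyclic_multipliers by blast
  obtain j where j: "\<forall>i<n. k * i mod n = i \<longrightarrow> a i * unity_root n ^ (i * j) = 1"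
    using fixed_coeffs_are_character[OF k(2)] by blast
  have "monomial_mat n k a * clock_mat n j \<in> S"
    using k(2) clock_pow_closed mult_closed by blast
  then have "monomial_mat n k (\<lambda>i. a i * unity_root n ^ (j * i)) \<in> S"
    by (simp only: monomial_mat_clock)
  moreover have "\<forall>i<n. k * i mod n = i \<longrightarrow> a i * unity_root n ^ (j * i) = 1"
    using j by (simp only: mult.commute)
  ultimately show ?thesis using k(1,3) by blast
qed

text \<open>The coefficients \<open>\<beta>\<close> of the \<open>r\<close>-th power form a
  character on the fixed points of \<open>k ^ r\<close> and are constant along cycles of
  \<open>k\<close>, whence \<open>n dvd (k - 1) * (i * c)\<close>. For \<open>p\<close> not dividing
  \<open>k - 1\<close> the character is trivial at \<open>i\<close>. Otherwise either the power is a
  clock matrix with nonzero trace, hence the identity, or \<open>i\<close> is already fixed by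
  \<open>k\<close> and the normalization applies.\<close>

lemma cycle_products_trivial:
  assumes B: "monomial_mat n k b \<in> S" and cop: "coprime k n"
    and normalized: "\<And>i. i < n \<Longrightarrow> k * i mod n = i \<Longrightarrow> b i = 1"
    and i: "i < n" "k ^ r * i mod n = i"
  shows "(\<Prod>s<r. b (k ^ s * i mod n)) = 1"
proof -
  define \<beta> where "\<beta> j = (\<Prod>s<r. b (k ^ s * j mod n))" for j
  have pow: "monomial_mat n k b ^\<^sub>m r = monomial_mat n (k ^ r) \<beta>"
    unfolding monomial_mat_pow \<beta>_def ..
  have M: "monomial_mat n (k ^ r) \<beta> \<in> S" using pow_closed[OF B, of r] unfolding pow .
  obtain c where c: "\<And>j. j < n \<Longrightarrow> k ^ r * j mod n = j \<Longrightarrow> \<beta> j * unity_root n ^ (j * c) = 1"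
    using fixed_coeffs_are_character[OF M] by blast
  \<comment> \<open>Positivity keeps \<open>k - 1\<close> and \<open>k ^ r - 1\<close> from being
    truncated.\<close>
  have k0: "k > 0" using cop n_gt_1 by (metis coprime_0_left_iff nat_neq_iff nat_dvd_1_iff_1 gr0I)
  \<comment> \<open>The power commutes with its base, so its coefficients are constant along cycles of \<open>k\<close>.\<close>
  have "monomial_mat n k b * monomial_mat n (k ^ r) \<beta> = monomial_mat n (k ^ r) \<beta> * monomial_mat n k b"
    unfolding pow[symmetric] by (rule pow_mat_commute[OF monomial_mat_carrier])
  then have "monomial_mat n (k * k ^ r) (\<lambda>j. \<beta> j * b (k ^ r * j mod n))
      = monomial_mat n (k * k ^ r) (\<lambda>j. b j * \<beta> (k * j mod n))"
    by (simp add: monomial_mat_mult mult.commute)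
  from monomial_mat_inject[OF this i(1)] have "\<beta> (k * i mod n) = \<beta> i"
    using i coeff_nonzero[OF B i(1)] by simp
  moreover have "k ^ r * (k * i mod n) mod n = k * i mod n"
  proof -
    have "k ^ r * (k * i mod n) mod n = k * (k ^ r * i mod n) mod n"
      by (simp add: mod_mult_right_eq ac_simps)
    then show ?thesis using i(2) by simp
  qed
  ultimately have "\<beta> i * unity_root n ^ (k * i mod n * c) = 1"
    using c[of "k * i mod n"] n_pos by simp
  with c[OF i] have "unity_root n ^ (k * i mod n * c) = unity_root n ^ (i * c)"
    by (metis mult_cancel_left mult_zero_left zero_neq_one)
  then have "[k * i mod n * c = i * c] (mod n)" using unity_root_power_eq_iff n_pos by blast
  moreover have "[k * i mod n * c = k * i * c] (mod n)" by (simp add: cong_def mod_mult_left_eq)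
  ultimately have "[k * i * c = i * c] (mod n)" using cong_sym cong_trans by blast
  then have dvd: "n dvd (k - 1) * (i * c)"
    using k0 by (simp add: cong_altdef_nat diff_mult_distrib mult.assoc)
  have \<beta>_eq: "\<beta> i = 1" if "n dvd i * c"
    using c[OF i] that unity_root_power_eq_1_iff[OF n_pos, of "i * c"] by simp
  have "\<beta> i = 1"
  proof (cases "p dvd k - 1")
    case False
    \<comment> \<open>Now \<open>k - 1\<close> cancels from the divisibility, leaving
      \<open>n dvd i * c\<close>.\<close>
    then have "coprime n (k - 1)"
      using prime_p by (simp add: n_def prime_imp_coprime)
    then show ?thesis using dvd \<beta>_eq coprime_dvd_mult_right_iff by blast
  next
    case p_dvd: True
    show ?thesis
    proof (cases "[k ^ r = 1] (mod n)")
      case True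
      \<comment> \<open>The power is a power of the clock matrix; a permutation with a fixed point keeps it in
        all its powers, so the trace does not vanish and the power is the identity.\<close>
      have fixed: "k ^ r * j mod n = j" if "j < n" for j
        using cong_mult[OF True cong_refl[of j n]] that by (simp add: cong_def)
      have "mtrace (monomial_mat n k b) = of_nat (card {i. i < n \<and> k * i mod n = i})"
        using normalized by (simp add: mtrace_monomial_mat)
      moreover have "0 \<in> {i. i < n \<and> k * i mod n = i}" using n_pos by simp
      then have "card {i. i < n \<and> k * i mod n = i} \<noteq> 0" by (auto simp: card_eq_0_iff)
      ultimately have "mtrace (monomial_mat n k b) \<noteq> 0" by simp
      then have "mtrace (monomial_mat n (k ^ r) \<beta>) \<noteq> 0"
        using mtrace_pow_nonzero[OF perm_like[OF B], of r] unfolding pow by blast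
      moreover have "mtrace (monomial_mat n (k ^ r) \<beta>) = cnj (\<Sum>j<n. unity_root n ^ (c * j))"
      proof -
        have "\<beta> j = cnj (unity_root n ^ (c * j))" if "j < n" for j
        proof -
          have "unity_root n ^ (c * j) * cnj (unity_root n ^ (c * j)) = 1"
            using complex_norm_square[of "unity_root n ^ (c * j)"] by (simp add: norm_power)
          then show ?thesis
            using c[OF that fixed[OF that]] by (metis mult.assoc mult.commute mult_1)
        qed
        moreover have "{i. i < n \<and> k ^ r * i mod n = i} = {..<n}" using fixed by auto
        ultimately show ?thesis by (simp add: mtrace_monomial_mat)
      qed
      ultimately have "n dvd c"
        using sum_unity_root_powers[OF n_pos, of c] by (auto split: if_splits)
      then show ?thesis by (intro \<beta>_eq) simp
    next
      case False
      \<comment> \<open>As \<open>k ^ r\<close> fixes \<open>i\<close> without being 1 modulo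
        \<open>n\<close>, \<open>i\<close> is no unit and \<open>p\<close> divides it. Together with
        \<open>p dvd k - 1\<close> this gives \<open>p\<^sup>2\<close> as a divisor of
        \<open>(k - 1) * i\<close>, so \<open>k\<close> itself fixes \<open>i\<close>.\<close>
      have "n dvd (k ^ r - 1) * i"
      proof -
        have "[k ^ r * i = i] (mod n)" using i by (simp add: cong_def)
        then show ?thesis using k0 by (simp add: cong_altdef_nat diff_mult_distrib)
      qed
      moreover have "\<not> n dvd k ^ r - 1"
        using False k0 by (simp add: cong_altdef_nat)
      ultimately have "\<not> coprime n i" using coprime_dvd_mult_left_iff by blast
      then have "p dvd i" using prime_p by (metis coprime_power_left_iff n_def prime_imp_coprime)
      then have "n dvd (k - 1) * i" using p_dvd by (simp add: n_def power2_eq_square mult_dvd_mono)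
      then have "[k * i = i] (mod n)"
        using k0 by (simp add: cong_altdef_nat diff_mult_distrib)
      then have ki: "k * i mod n = i" using i(1) by (simp add: cong_def)
      show ?thesis unfolding \<beta>_def using power_fixes[OF i(1) ki] normalized[OF i(1) ki] by simp
    qed
  qed
  then show ?thesis unfolding \<beta>_def .
qed

lemma simultaneously_permutation:
  "\<exists>Q R. Q \<in> carrier_mat n n \<and> R \<in> carrier_mat n n \<and> Q * R = 1\<^sub>m n \<and> R * Q = 1\<^sub>m n \<and>
    (\<forall>A\<in>S. permutation_matrix n (R * A * Q))"
proof -
  obtain k b where cop: "coprime k n" and B: "monomial_mat n k b \<in> S"
    and normalized: "\<And>i. i < n \<Longrightarrow> k * i mod n = i \<Longrightarrow> b i = 1"
    and gen: "\<And>A. A \<in> S \<Longrightarrow> \<exists>e a. A = monomial_mat n (k ^ e) a"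
    using normalized_generator by blast
  obtain l where l: "[l * k = 1] (mod n)"
    using cong_solve_coprime_nat[OF cop] by (metis One_nat_def mult.commute)
  then have cop_l: "coprime l n"
    by (metis coprime_iff_invertible_nat One_nat_def)
  obtain N where N: "N > 0" "\<And>i. i < n \<Longrightarrow> k ^ N * i mod n = i"
    using coeff_cycle_root[OF B] by metis
  define f where "f i = k * i mod n" for i
  have f_pow: "(f ^^ s) i = k ^ s * i mod n" if "i < n" for i s
    by (induction s) (use that in \<open>simp_all add: f_def mod_mult_right_eq mult.assoc\<close>)
  \<comment> \<open>The equation says that the monomial matrix of \<open>b\<close> fixes the vector
    \<open>w\<close>.\<close>
  have "\<exists>w. \<forall>i\<in>{..<n}. w i \<noteq> 0 \<and> w (f i) = b i * w i"
  proof (rule cocycle_is_coboundary[OF _ N(1)])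
    show "f i \<in> {..<n}" for i using n_pos by (simp add: f_def)
    show "(f ^^ N) i = i" if "i \<in> {..<n}" for i using f_pow N(2) that by simp
    show "b i \<noteq> 0" if "i \<in> {..<n}" for i using coeff_nonzero[OF B] that by simp
    show "(\<Prod>s<r. b ((f ^^ s) i)) = 1" if "i \<in> {..<n}" "(f ^^ r) i = i" for i r
      using cycle_products_trivial[OF B cop normalized, of i r] f_pow that by simp
  qed
  then obtain w where w: "\<And>i. i < n \<Longrightarrow> w i \<noteq> 0" "\<And>i. i < n \<Longrightarrow> w (k * i mod n) = b i * w i"
    unfolding f_def by auto
  define Q where "Q = weighted_dft n w"
  have Q: "Q \<in> carrier_mat n n" by (simp add: Q_def)
  obtain R where R: "R \<in> carrier_mat n n" "Q * R = 1\<^sub>m n" "R * Q = 1\<^sub>m n"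
    using weighted_dft_inverse[of n w] w(1) unfolding Q_def by blast
  define good where "good A \<longleftrightarrow> permutation_matrix n (R * A * Q)" for A
  have goodI: "good A" if "A \<in> carrier_mat n n" "A * Q = Q * P" "permutation_matrix n P" for A P
  proof -
    have P: "P \<in> carrier_mat n n" using that(3) unfolding permutation_matrix_def by auto
    have "R * A * Q = R * (Q * P)" using that(1,2) Q R(1) by (simp add: assoc_mult_mat[of R n n A n Q n])
    also have "\<dots> = R * Q * P" using Q R(1) P by (simp add: assoc_mult_mat[of R n n Q n P n])
    also have "\<dots> = P" using R(3) P by (simp add: left_mult_one_mat[of P n n])
    finally show ?thesis using that(3) unfolding good_def by simp
  qed
  \<comment> \<open>Closure under products reduces the claim to the normalized generator and the
    clock matrices.\<close>
  have good_mult: "good (A * A')"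
    if "A \<in> carrier_mat n n" "A' \<in> carrier_mat n n" "good A" "good A'" for A A'
    using conj_mat_mult[OF that(1,2) Q R(1,2)] permutation_matrix_mult that(3,4)
    unfolding good_def by metis
  have good_one: "good (1\<^sub>m n)"
    by (rule goodI[OF _ _ permutation_matrix_one])
      (use Q in \<open>simp_all add: left_mult_one_mat[of _ n n] right_mult_one_mat[of _ n n]\<close>)
  have good_B: "good (monomial_mat n k b)"
  proof (rule goodI[OF _ _ affine_permutation_matrix[OF cop_l, of 0]])
    show "monomial_mat n k b * Q = Q * perm_mat n (\<lambda>j. l * (0 + j) mod n)"
      unfolding Q_def by (rule monomial_mat_permutes_weighted_dft[OF l]) (simp add: w(2))
  qed simp
  have good_pow: "good (monomial_mat n k b ^\<^sub>m e)" for e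
  proof (induction e)
    case (Suc e)
    then show ?case using good_mult[OF _ _ _ good_B] by simp
  qed (simp add: good_one)
  have good_clock: "good (clock_mat n s)" for s
  proof (rule goodI[OF _ _ affine_permutation_matrix[of 1 n s]])
    show "clock_mat n s * Q = Q * perm_mat n (\<lambda>j. 1 * (s + j) mod n)"
      unfolding Q_def clock_mat_def by (rule monomial_mat_permutes_weighted_dft) simp_all
  qed (simp_all add: clock_mat_def)
  have "good A" if A: "A \<in> S" for A
  proof -
    obtain e a where e: "A = monomial_mat n (k ^ e) a" using gen[OF A] by blast
    \<comment> \<open>\<open>M\<close> is the power of the generator with the same multiplier as
      \<open>A\<close>. Hence \<open>A\<close> times its inverse has multiplier 1 and is a clock
      matrix.\<close>
    define M where "M = monomial_mat n k b ^\<^sub>m e"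
    have M: "M \<in> S" unfolding M_def by (rule pow_closed[OF B])
    then obtain M' where M': "M' \<in> S" "M * M' = 1\<^sub>m n" "M' * M = 1\<^sub>m n"
      using inverse_closed by blast
    obtain k' b' where k': "M' = monomial_mat n k' b'" using monomial[OF M'(1)] by blast
    have "[k ^ e * k' = 1] (mod n)"
      using M'(2) n_gt_1 unfolding M_def k' monomial_mat_pow monomial_mat_mult
      by (rule monomial_mat_eq_one)
    moreover have "A * M' = monomial_mat n (k ^ e * k') (\<lambda>j. b' j * a (k' * j mod n))"
      unfolding e k' monomial_mat_mult ..
    ultimately obtain s where s: "A * M' = clock_mat n s"
      using centralizer_is_clock mult_closed[OF A M'(1)] by metis
    have "A = A * (M' * M)" using carrier[OF A] by (simp add: M'(3) right_mult_one_mat[of _ n n])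
    also have "\<dots> = A * M' * M"
      by (rule assoc_mult_mat[symmetric, OF carrier[OF A] carrier[OF M'(1)] carrier[OF M]])
    finally have "A = clock_mat n s * M" unfolding s .
    moreover have "good (clock_mat n s * M)"
      using good_mult[OF carrier[OF clock_pow_closed] carrier[OF M] good_clock] good_pow
      unfolding M_def by blast
    ultimately show ?thesis by simp
  qed
  then show ?thesis using Q R unfolding good_def by blast
qed

end

section \<open>Reduction to the monomial case\<close>

lemma similar_mat_intertwine:
  assumes A: "A \<in> carrier_mat n n" and B: "B \<in> carrier_mat n n"
    and X: "X \<in> carrier_mat n n" and Y: "Y \<in> carrier_mat n n"
    and XY: "X * Y = 1\<^sub>m n" "Y * X = 1\<^sub>m n" and AX: "A * X = X * B"
  shows "similar_mat A B"
proof (rule similar_matI[of A B X Y n])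
  have "A = A * (X * Y)" using A by (simp add: XY right_mult_one_mat[OF A])
  also have "\<dots> = X * B * Y" unfolding assoc_mult_mat[OF A X Y, symmetric] AX ..
  finally show "A = X * B * Y" .
qed (use A B X Y XY in simp_all)

text \<open>Relabelling the indices by their positions in \<open>cs\<close> turns the cycle into the
  shift by one, and the unweighted Fourier matrix diagonalises the shift.\<close>

lemma cycle_similar_clock:
  assumes cs: "cycle cs" "set cs = {..<n}"
  shows "similar_mat (perm_mat n (cycle_of_list cs)) (clock_mat n 1)"
proof -
  have len: "length cs = n" using distinct_card[OF cs(1)] cs(2) by simp
  define \<tau> where "\<tau> j = (if j < n then cs ! j else j)" for j
  have "bij_betw ((!) cs) {..<n} {..<n}" using bij_betw_nth[OF cs(1)] len cs(2) by simp
  then have "bij_betw \<tau> {..<n} {..<n}" by (rule bij_betw_cong[THEN iffD1, rotated]) (simp add: \<tau>_def)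
  then have \<tau>: "\<tau> permutes {..<n}" by (rule bij_imp_permutes) (simp add: \<tau>_def)
  \<comment> \<open>The shift is written with a factor 1 to match the affine form in
    \<open>monomial_mat_permutes_weighted_dft\<close> with \<open>l = s = 1\<close>.\<close>
  let ?\<sigma> = "cycle_of_list cs" and ?shift = "perm_mat n (\<lambda>j. 1 * (1 + j) mod n)"
  have step: "?\<sigma> (cs ! j) = cs ! ((1 + j) mod n)" if "j < n" for j
    using arg_cong[OF cyclic_rotation[OF cs(1), of 1], of "\<lambda>xs. xs ! j"] that len
    by (simp add: nth_rotate1 nth_rotate)
  have "similar_mat (perm_mat n ?\<sigma>) ?shift"
  proof (rule similar_mat_intertwine)
    show "perm_mat n \<tau> * perm_mat n (inv_into UNIV \<tau>) = 1\<^sub>m n" "perm_mat n (inv_into UNIV \<tau>) * perm_mat n \<tau> = 1\<^sub>m n"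
      using \<tau> permutes_inv[OF \<tau>]
      by (simp_all add: perm_mat_mult permutes_inv_o[OF \<tau>] perm_mat_id)
    show "perm_mat n ?\<sigma> * perm_mat n \<tau> = perm_mat n \<tau> * ?shift"
    proof (rule eq_matI)
      fix i j assume "i < dim_row (perm_mat n \<tau> * ?shift)" "j < dim_col (perm_mat n \<tau> * ?shift)"
      then have ij: "i < n" "j < n" by simp_all
      then have lt: "\<tau> j < n" "1 * (1 + j) mod n < n" using permutes_in_image[OF \<tau>, of j] by simp_all
      show "(perm_mat n ?\<sigma> * perm_mat n \<tau>) $$ (i, j) = (perm_mat n \<tau> * ?shift) $$ (i, j)"
        unfolding mult_perm_mat_index[where \<sigma> = \<tau>, OF perm_mat_carrier ij lt(1)]
          mult_perm_mat_index[where \<sigma> = "\<lambda>j. 1 * (1 + j) mod n", OF perm_mat_carrier ij lt(2)]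
        using ij lt step[OF ij(2)] by (simp add: perm_mat_def \<tau>_def)
    qed simp_all
  qed simp_all
  moreover have "similar_mat (clock_mat n 1) ?shift"
  proof -
    let ?W = "weighted_dft n (\<lambda>_. 1)"
    obtain R where "R \<in> carrier_mat n n" "?W * R = 1\<^sub>m n" "R * ?W = 1\<^sub>m n"
      by (rule weighted_dft_inverse[of n "\<lambda>_. 1"]) simp
    moreover have "clock_mat n 1 * ?W = ?W * ?shift"
      unfolding clock_mat_def by (rule monomial_mat_permutes_weighted_dft) simp_all
    ultimately show ?thesis
      by (intro similar_mat_intertwine[of _ n _ ?W R]) (simp_all add: clock_mat_def)
  qed
  ultimately show ?thesis using similar_mat_sym similar_mat_trans by blast
qed

lemma clock_mat_mult_index:
  assumes "A \<in> carrier_mat n m" "i < n" "j < m"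
  shows "(clock_mat n s * A) $$ (i, j) = unity_root n ^ (s * i) * A $$ (i, j)"
proof -
  have "(clock_mat n s * A) $$ (i, j) = (\<Sum>t<n. clock_mat n s $$ (i, t) * A $$ (t, j))"
    using assms by (simp add: clock_mat_def scalar_prod_def atLeast0LessThan)
  also have "\<dots> = (\<Sum>t<n. if t = i then unity_root n ^ (s * i) * A $$ (i, j) else 0)"
    using assms by (intro sum.cong) (auto simp: clock_mat_def monomial_mat_def)
  also have "\<dots> = unity_root n ^ (s * i) * A $$ (i, j)" using assms by simp
  finally show ?thesis .
qed

text \<open>Comparing entries gives \<open>unity_root n ^ i * A $$ (i, j) = unity_root n ^ (s * j) *
  A $$ (i, j)\<close>. The eigenvalues of the clock matrix are distinct, so only the row
  \<open>s * j mod n\<close> survives in column \<open>j\<close>.\<close>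

lemma clock_intertwiner_is_monomial:
  assumes A: "A \<in> carrier_mat n n" and comm: "clock_mat n 1 * A = A * clock_mat n s"
  shows "A = monomial_mat n s (\<lambda>j. A $$ (s * j mod n, j))"
proof (rule eq_matI)
  fix i j assume "i < dim_row (monomial_mat n s (\<lambda>j. A $$ (s * j mod n, j)))"
    "j < dim_col (monomial_mat n s (\<lambda>j. A $$ (s * j mod n, j)))"
  then have ij: "i < n" "j < n" by simp_all
  have "A $$ (i, j) = 0" if "i \<noteq> s * j mod n"
  proof -
    have "unity_root n ^ i * A $$ (i, j) = (clock_mat n 1 * A) $$ (i, j)"
      using clock_mat_mult_index[OF A ij, of 1] by simp
    also have "\<dots> = unity_root n ^ (s * j) * A $$ (i, j)"
      unfolding comm using mult_monomial_mat_index[OF A ij] ij by (simp add: clock_mat_def)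
    finally have "unity_root n ^ i = unity_root n ^ (s * j) \<or> A $$ (i, j) = 0" by auto
    moreover have "\<not> [i = s * j] (mod n)" using that ij by (simp add: cong_def)
    ultimately show ?thesis using unity_root_power_eq_iff[of n i "s * j"] ij by auto
  qed
  then show "A $$ (i, j) = monomial_mat n s (\<lambda>j. A $$ (s * j mod n, j)) $$ (i, j)"
    using ij by (auto simp: monomial_mat_def)
qed (use A in simp_all)

section \<open>The general linear group and the relation imposed by normality\<close>

lemma GL_simps [simp]: "mult (GL n) = (*)" "one (GL n) = 1\<^sub>m n"
  by (simp_all add: GL_def units_of_def ring_mat_def)

lemma group_GL: "group (GL n)"
proof -
  interpret ring "ring_mat TYPE(complex) n ()" by (rule ring_mat)
  show ?thesis unfolding GL_def by (rule units_group)
qed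

lemma GL_carrier_iff:
  "A \<in> carrier (GL n) \<longleftrightarrow> A \<in> carrier_mat n n \<and> (\<exists>B\<in>carrier_mat n n. B * A = 1\<^sub>m n \<and> A * B = 1\<^sub>m n)"
  by (auto simp: GL_def units_of_def Units_def ring_mat_def)

lemma GL_nat_pow:
  assumes "A \<in> carrier (GL n)"
  shows "A [^]\<^bsub>GL n\<^esub> (k::nat) = A ^\<^sub>m k"
proof -
  have "dim_row A = n" using assms by (auto simp: GL_carrier_iff)
  then show ?thesis by (induction k) (simp_all add: nat_pow_def)
qed

text \<open>The conjugate of \<open>C\<close> by the inverse of \<open>A\<close> stays in the
  generated subgroup. Finite order of \<open>C\<close> makes it a power with a natural exponent, as
  matrix powers require.\<close>

lemma normal_generate_conjugate:
  assumes G: "subgroup G (GL n)" and C: "C \<in> G" "C ^\<^sub>m N = 1\<^sub>m n" "N > 0"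
    and normal: "generate (GL n) {C} \<lhd> (GL n)\<lparr>carrier := G\<rparr>"
    and A: "A \<in> G"
  shows "\<exists>s. C * A = A * C ^\<^sub>m s"
proof -
  interpret GL: group "GL n" by (rule group_GL)
  have carr: "A \<in> carrier (GL n)" "C \<in> carrier (GL n)" using subgroup.mem_carrier[OF G] A C(1) by auto
  have "C [^]\<^bsub>GL n\<^esub> N = \<one>\<^bsub>GL n\<^esub>" using C(2) GL_nat_pow[OF carr(2)] by simp
  then have "GL.ord C dvd N" using GL.pow_eq_id[OF carr(2)] by blast
  then have "GL.ord C \<noteq> 0" using C(3) by auto
  have "C \<in> generate (GL n) {C}" by (rule generate.incl) simp
  then have "inv\<^bsub>(GL n)\<lparr>carrier := G\<rparr>\<^esub> A \<otimes>\<^bsub>(GL n)\<lparr>carrier := G\<rparr>\<^esub> C \<otimes>\<^bsub>(GL n)\<lparr>carrier := G\<rparr>\<^esub> A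
      \<in> generate (GL n) {C}"
    using normal.inv_op_closed1[OF normal, of A C] A by simp
  then have "inv\<^bsub>GL n\<^esub> A \<otimes>\<^bsub>GL n\<^esub> C \<otimes>\<^bsub>GL n\<^esub> A \<in> generate (GL n) {C}"
    using GL.m_inv_consistent[OF G A] by simp
  then obtain s :: nat where s: "inv\<^bsub>GL n\<^esub> A \<otimes>\<^bsub>GL n\<^esub> C \<otimes>\<^bsub>GL n\<^esub> A = C [^]\<^bsub>GL n\<^esub> s"
    unfolding GL.generate_pow_nat[OF carr(2) \<open>GL.ord C \<noteq> 0\<close>] by blast
  have "C \<otimes>\<^bsub>GL n\<^esub> A = A \<otimes>\<^bsub>GL n\<^esub> C [^]\<^bsub>GL n\<^esub> s"
    unfolding s[symmetric] using carr by (simp add: GL.m_assoc[symmetric] del: GL_simps)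
  then show ?thesis using GL_nat_pow[OF carr(2)] by auto
qed

theorem theorem1p1:
  fixes p :: nat and G :: "complex mat set" and C :: "complex mat"
  assumes "Factorial_Ring.prime p"
    and "matrix_group (p\<^sup>2) G"
    and "permutation_like (p\<^sup>2) G"
    and "C \<in> G"
    and "maximal_cycle (p\<^sup>2) C"
    and "generate (GL (p\<^sup>2)) {C} \<lhd> (GL (p\<^sup>2))\<lparr>carrier := G\<rparr>"
  shows "\<exists>Q \<in> carrier (GL (p\<^sup>2)). \<forall>A\<in>G.
    permutation_matrix (p\<^sup>2) (inv\<^bsub>GL (p\<^sup>2)\<^esub> Q * A * Q)"
proof -
  define n where "n = p\<^sup>2"
  interpret GL: group "GL n" by (rule group_GL)
  have n1: "n > 1" using one_less_power[OF prime_gt_1_nat[OF assms(1)], of 2] by (simp add: n_def)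
  have sub: "subgroup G (GL n)" using assms(2) by (simp add: matrix_group_def n_def)
  have GL_G: "A \<in> carrier (GL n)" if "A \<in> G" for A using subgroup.mem_carrier[OF sub that] .
  have carr: "A \<in> carrier_mat n n" if "A \<in> G" for A using GL_G[OF that] by (simp add: GL_carrier_iff)
  obtain cs where cs: "cycle cs" "set cs = {..<n}" "similar_mat C (perm_mat n (cycle_of_list cs))"
    using assms(5) unfolding maximal_cycle_def n_def[symmetric] by blast
  obtain U V where wit: "similar_mat_wit C (clock_mat n 1) U V"
    using similar_mat_trans[OF cs(3) cycle_similar_clock[OF cs(1,2)]]
    unfolding similar_mat_def by blast
  note w = similar_mat_witD2[OF carr[OF assms(4)] wit]
  note UV = w(1,2) and U = w(6) and V = w(7)
  \<comment> \<open>Conjugation into the eigenbasis of \<open>C\<close>, where \<open>C\<close>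
    becomes the clock matrix.\<close>
  define \<phi> where "\<phi> A = V * A * U" for A
  have \<phi>_carr: "\<phi> A \<in> carrier_mat n n" if "A \<in> carrier_mat n n" for A
    unfolding \<phi>_def using mult_carrier_mat[OF mult_carrier_mat[OF V that] U] .
  have \<phi>_mult: "\<phi> (A * B) = \<phi> A * \<phi> B" if "A \<in> carrier_mat n n" "B \<in> carrier_mat n n" for A B
    unfolding \<phi>_def using conj_mat_mult[OF that U V UV(1)] by simp
  have \<phi>_one: "\<phi> (1\<^sub>m n) = 1\<^sub>m n"
    unfolding \<phi>_def right_mult_one_mat[OF V] by (rule UV(2))
  have \<phi>_C: "\<phi> (C ^\<^sub>m s) = clock_mat n s" for s
    using similar_mat_wit_pow_id[OF similar_mat_wit_sym[OF wit], of s]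
    unfolding \<phi>_def clock_mat_pow by simp
  have \<phi>_C1: "\<phi> C = clock_mat n 1"
    using similar_mat_witD(3)[OF refl similar_mat_wit_sym[OF wit]] unfolding \<phi>_def by simp
  have C_pow: "C ^\<^sub>m n = 1\<^sub>m n"
  proof -
    have "clock_mat n n = 1\<^sub>m n"
      unfolding clock_mat_def monomial_mat_one[symmetric]
      using n1 by (intro monomial_mat_cong) (auto simp: unity_root_power_eq_1_iff)
    then have "C ^\<^sub>m n = U * 1\<^sub>m n * V"
      using similar_mat_wit_pow_id[OF wit, of n] by (simp only: clock_mat_pow)
    then show ?thesis unfolding right_mult_one_mat[OF U] UV(1) .
  qed
  have inv_G: "\<exists>B\<in>G. A * B = 1\<^sub>m n \<and> B * A = 1\<^sub>m n" if "A \<in> G" for A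
    using subgroup.m_inv_closed[OF sub that] GL.r_inv[OF GL_G[OF that]] GL.l_inv[OF GL_G[OF that]]
    by auto
  have mono: "\<exists>k a. \<phi> A = monomial_mat n k a" if A: "A \<in> G" for A
  proof -
    \<comment> \<open>Under \<open>\<phi>\<close> this relation makes the image of \<open>A\<close>
      intertwine two powers of the clock matrix, which forces the monomial shape.\<close>
    obtain s where s: "C * A = A * C ^\<^sub>m s"
      using normal_generate_conjugate[OF sub assms(4) C_pow _ assms(6)[folded n_def] A] n1 by auto
    have "clock_mat n 1 * \<phi> A = \<phi> (C * A)"
      using \<phi>_mult[OF carr[OF assms(4)] carr[OF A]] \<phi>_C1 by simp
    also have "\<dots> = \<phi> A * clock_mat n s"
      unfolding s using \<phi>_mult[OF carr[OF A] pow_carrier_mat[OF carr[OF assms(4)]], of s] \<phi>_C by simp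
    finally show ?thesis using clock_intertwiner_is_monomial[OF \<phi>_carr[OF carr[OF A]]] by blast
  qed
  interpret S: monomial_perm_like_group p n "\<phi> ` G"
  proof
    show "Factorial_Ring.prime p" "n = p\<^sup>2" by (simp_all add: assms(1) n_def)
    show "A * B \<in> \<phi> ` G" if AB: "A \<in> \<phi> ` G" "B \<in> \<phi> ` G" for A B
    proof -
      obtain A' B' where "A' \<in> G" "B' \<in> G" "A = \<phi> A'" "B = \<phi> B'" using AB by blast
      then show ?thesis
        using \<phi>_mult[OF carr[of A'] carr[of B']] subgroup.m_closed[OF sub, of A' B']
          imageI[of "A' * B'" G \<phi>] by simp
    qed
    show inv: "\<exists>B\<in>\<phi> ` G. A * B = 1\<^sub>m n \<and> B * A = 1\<^sub>m n" if A: "A \<in> \<phi> ` G" for A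
    proof -
      obtain A' where A': "A' \<in> G" "A = \<phi> A'" using A by blast
      obtain B' where B': "B' \<in> G" "A' * B' = 1\<^sub>m n" "B' * A' = 1\<^sub>m n"
        using inv_G[OF A'(1)] by blast
      have "A * \<phi> B' = 1\<^sub>m n" "\<phi> B' * A = 1\<^sub>m n"
        unfolding A'(2) \<phi>_mult[OF carr[OF A'(1)] carr[OF B'(1)], symmetric]
          \<phi>_mult[OF carr[OF B'(1)] carr[OF A'(1)], symmetric] B'(2,3) \<phi>_one by simp_all
      then show ?thesis using B'(1) by blast
    qed
    show "clock_mat n 1 \<in> \<phi> ` G"
      unfolding \<phi>_C1[symmetric] using assms(4) by (rule imageI)
    show "\<exists>k a. coprime k n \<and> A = monomial_mat n k a" if A: "A \<in> \<phi> ` G" for A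
    proof -
      obtain k a where ka: "A = monomial_mat n k a" using mono A by blast
      \<comment> \<open>The inverse is monomial as well, so the two multipliers are inverse to each
        other modulo \<open>n\<close> and hence units.\<close>
      obtain B where "B \<in> \<phi> ` G" "A * B = 1\<^sub>m n" using inv[OF A] by blast
      moreover from this(1) obtain k' b where "B = monomial_mat n k' b" using mono by blast
      ultimately have "[k * k' = 1] (mod n)"
        using n1 unfolding ka by (simp only: monomial_mat_mult) (rule monomial_mat_eq_one)
      then have "coprime k n" by (metis coprime_iff_invertible_nat One_nat_def)
      then show ?thesis using ka by blast
    qed
    show "similar_to_perm n A" if A: "A \<in> \<phi> ` G" for A
    proof -
      obtain B where B: "B \<in> G" "A = \<phi> B" using A by blast
      have "similar_mat A B"
        using B carr[OF B(1)] \<phi>_carr[OF carr[OF B(1)]] U V UV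
        by (intro similar_matI[of A B V U n]) (simp_all add: \<phi>_def)
      then show ?thesis
        using assms(3) B(1) similar_mat_trans
        unfolding similar_to_perm_def permutation_like_def n_def[symmetric] by blast
    qed
  qed
  obtain Q R where Q: "Q \<in> carrier_mat n n" and R: "R \<in> carrier_mat n n"
    and QR: "Q * R = 1\<^sub>m n" "R * Q = 1\<^sub>m n"
    and perm: "\<And>A. A \<in> G \<Longrightarrow> permutation_matrix n (R * \<phi> A * Q)"
    using S.simultaneously_permutation by blast
  \<comment> \<open>The final basis change composes the diagonalisation \<open>U\<close> of
    \<open>C\<close> with the basis \<open>Q\<close> permuted by the monomial group;
    \<open>R * V\<close> is its inverse.\<close>
  have UQ: "U * Q \<in> carrier_mat n n" and RV: "R * V \<in> carrier_mat n n" using U V Q R by simp_all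
  have 1: "R * V * (U * Q) = 1\<^sub>m n"
  proof -
    have "R * V * (U * Q) = R * (V * U) * Q"
      unfolding assoc_mult_mat[OF RV U Q, symmetric] assoc_mult_mat[OF R V U] ..
    then show ?thesis unfolding UV(2) right_mult_one_mat[OF R] QR(2) .
  qed
  have 2: "U * Q * (R * V) = 1\<^sub>m n" by (rule mat_mult_left_right_inverse[OF RV UQ 1])
  have UQ_GL: "U * Q \<in> carrier (GL n)" and RV_GL: "R * V \<in> carrier (GL n)"
    using UQ RV 1 2 by (auto simp: GL_carrier_iff)
  have inv: "inv\<^bsub>GL n\<^esub> (U * Q) = R * V"
    by (rule GL.inv_equality) (simp_all add: 1 UQ_GL RV_GL)
  have "permutation_matrix n (inv\<^bsub>GL n\<^esub> (U * Q) * A * (U * Q))" if "A \<in> G" for A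
  proof -
    note A = carr[OF that]
    have VA: "V * A \<in> carrier_mat n n" using V A by simp
    have "R * V * A * (U * Q) = R * (V * A) * U * Q"
      unfolding assoc_mult_mat[OF R V A]
      by (rule assoc_mult_mat[symmetric, OF mult_carrier_mat[OF R VA] U Q])
    also have "\<dots> = R * \<phi> A * Q" unfolding \<phi>_def assoc_mult_mat[OF R VA U] ..
    finally show ?thesis using perm[OF that] unfolding inv by simp
  qed
  then show ?thesis using UQ_GL unfolding n_def by blast
qed

end
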